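(* As $n\to\infty$, \[\max_{X\subseteq\mathbb{R}^2,\ |X|=n}\bigl(a_1(X)-a_2(X)\bigr)=\Omega(n\log n).\] That is, there exist $c>0$ and $n_0$ such that for every $n\geq n_0$ there is a set $X\subseteq\mathbb{R}^2$ of $n$ points with $a_1(X)-a_2(X)\geq c\,n\log n$.
   Context: For a finite set $X\subseteq\mathbb{R}^2$ determining $m$ distinct Euclidean distances between its points, the multiplicity of a distance is the number of unordered pairs of distinct points of $X$ at that distance, and $a_1(X)\geq a_2(X)\geq\cdots\geq a_m(X)$ denote the multiplicities of the $m$ distances in non-increasing order. *)

theory Defs
  imports "HOL-Analysis.Analysis" "HOL-Library.Multiset"
begin

definition distances :: "(real ^ 2) set \<Rightarrow> real set" where
  "distances X = {dist x y | x y. x \<in> X \<and> y \<in> X \<and> x \<noteq> y}"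

definition multiplicity_of :: "(real ^ 2) set \<Rightarrow> real \<Rightarrow> nat" where
  "multiplicity_of X d = card {{x, y} | x y. x \<in> X \<and> y \<in> X \<and> x \<noteq> y \<and> dist x y = d}"

text \<open>
  One entry per distinct distance, so that equal multiplicities of different
  distances are repeated in the list.  Meaningful for finite X only.
\<close>

definition multiplicity_list :: "(real ^ 2) set \<Rightarrow> nat list" where
  "multiplicity_list X =
     rev (sorted_list_of_multiset (image_mset (multiplicity_of X) (mset_set (distances X))))"

text \<open>
  Indices start at 1.  The value is 0 by convention when the index exceeds the number m
  of distinct distances; a finite planar set with at least four points has m at least 2.
\<close>

definition dist_mult :: "nat \<Rightarrow> (real ^ 2) set \<Rightarrow> nat" where
  "dist_mult k X =
     (if 1 \<le> k \<and> k \<le> card (distances X) then multiplicity_list X ! (k - 1) else 0)"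

end

theory Submission
  imports Defs
begin

text \<open>
  Start from a point and repeatedly replace X by its union with X + v, where v is a
  generic unit vector.  A nonzero difference w of X contributes the distance \<open>norm (w - v)\<close>
  between the two copies; for generic v these distances are new, different from 1, and pairwise
  different for different w, so after k steps every distance other than 1 comes from
  \<open>O(2^k)\<close> pairs.  The zero difference contributes distance 1, so distance 1 comes from
  \<open>k * 2^k\<close> ordered pairs.  As both bounds are monotone in the set, any set between two
  consecutive steps handles the values of n that are not powers of two.
\<close>

section \<open>Generic unit vectors in the plane\<close>

text \<open>A line meets a circle in at most two points. With \<open>?f v\<close> the inner product
  of \<open>v\<close> with \<open>u\<close> turned by a right angle, Lagrange's identity determines
  the square of \<open>?f v\<close> from \<open>norm u\<close>, \<open>r\<close> and
  \<open>c\<close>; and \<open>v\<close> is recovered from its inner products with two orthogonal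
  nonzero vectors.\<close>

lemma finite_sphere_Int_hyperplane_2:
  fixes u :: "real ^ 2"
  assumes "u \<noteq> 0"
  shows "finite {v. norm v = r \<and> u \<bullet> v = c}"
proof (rule finite_imageD)
  let ?S = "{v. norm v = r \<and> u \<bullet> v = c}"
  let ?f = "\<lambda>v::real^2. u $ 2 * v $ 1 - u $ 1 * v $ 2"
  define K where "K = (norm u)\<^sup>2 * r\<^sup>2 - c\<^sup>2"
  have nrm: "(norm x)\<^sup>2 = (x $ 1)\<^sup>2 + (x $ 2)\<^sup>2" for x :: "real^2"
    unfolding power2_norm_eq_inner by (simp add: inner_vec_def sum_2 power2_eq_square)
  have "(?f v)\<^sup>2 = K" if "v \<in> ?S" for v
  proof -
    have "(norm u)\<^sup>2 * (norm v)\<^sup>2 - (u \<bullet> v)\<^sup>2 = (?f v)\<^sup>2"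
      unfolding nrm by (simp add: inner_vec_def sum_2 power2_eq_square algebra_simps)
    then show ?thesis using that by (simp add: K_def)
  qed
  then have "\<bar>?f v\<bar> = sqrt K" if "v \<in> ?S" for v
    using that by (simp flip: real_sqrt_abs)
  then have "?f v \<in> {sqrt K, - sqrt K}" if "v \<in> ?S" for v
    using that by (force simp: abs_if split: if_splits)
  then have "?f ` ?S \<subseteq> {sqrt K, - sqrt K}" by blast
  then show "finite (?f ` ?S)" by (rule finite_subset) simp
  show "inj_on ?f ?S"
  proof (rule inj_onI)
    fix v w assume v: "v \<in> ?S" and w: "w \<in> ?S" and eq: "?f v = ?f w"
    define d where "d = v - w"
    have a: "u $ 1 * d $ 1 + u $ 2 * d $ 2 = 0"
      using v w by (simp add: d_def inner_vec_def sum_2 algebra_simps)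
    have b: "u $ 2 * d $ 1 - u $ 1 * d $ 2 = 0"
      using eq by (simp add: d_def algebra_simps)
    have "(norm u)\<^sup>2 * (norm d)\<^sup>2
        = (u $ 1 * d $ 1 + u $ 2 * d $ 2)\<^sup>2 + (u $ 2 * d $ 1 - u $ 1 * d $ 2)\<^sup>2"
      unfolding nrm by (simp add: power2_eq_square algebra_simps)
    then have "(norm u)\<^sup>2 * (norm d)\<^sup>2 = 0" by (simp add: a b)
    then show "v = w" using assms by (simp add: d_def)
  qed
qed

text \<open>A finite connected set has at most one point, whereas the circle is connected and
  contains two antipodal points.\<close>

lemma infinite_sphere_2: "infinite (sphere (0::real^2) 1)"
proof
  assume "finite (sphere (0::real^2) 1)"
  moreover have "connected (sphere (0::real^2) 1)"
    by (rule connected_sphere) simp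
  ultimately obtain a where a: "sphere (0::real^2) 1 \<subseteq> {a}"
    by (metis connected_finite_iff_sing empty_subsetI subset_refl)
  have "axis 1 1 \<in> sphere (0::real^2) 1" "- axis 1 1 \<in> sphere (0::real^2) 1"
    by simp_all
  then have "axis 1 1 = a" "- axis 1 1 = a"
    using a by blast+
  then have "(axis 1 1 :: real^2) $ 1 = (- axis 1 1 :: real^2) $ 1"
    by metis
  then show False by simp
qed

text \<open>For a unit vector \<open>v\<close>, the square of \<open>norm (w - v)\<close> is affine
  in \<open>v\<close>, so each forbidden coincidence puts \<open>v\<close> on a line. There are
  finitely many such lines, each meeting the unit circle in finitely many points, so some
  \<open>v\<close> avoids them all. The vector \<open>w = 0\<close> is excepted because
  \<open>norm (0 - v)\<close> is always 1.\<close>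

lemma ex_generic_unit_vector:
  fixes W :: "(real ^ 2) set"
  assumes "finite W" "finite T"
  obtains v where "norm v = 1"
    "\<And>w. w \<in> W \<Longrightarrow> w \<noteq> 0 \<Longrightarrow> norm (w - v) \<notin> T"
    "inj_on (\<lambda>w. norm (w - v)) W"
proof -
  \<comment> \<open>\<open>B1\<close> contains every unit vector with
    \<open>norm (w - v) = t\<close> for some nonzero \<open>w\<close> and some \<open>t\<close> in
    \<open>T\<close>; \<open>B2\<close> consists of those with
    \<open>norm (w - v) = norm (w' - v)\<close> for some distinct \<open>w\<close>,
    \<open>w'\<close>.\<close>
  define B1 where "B1 = (\<Union>w\<in>W-{0}. \<Union>t\<in>T. {v. norm v = 1 \<and> w \<bullet> v = ((norm w)\<^sup>2 + 1 - t\<^sup>2) / 2})"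
  define B2 where "B2 = (\<Union>w\<in>W. \<Union>w'\<in>W-{w}. {v. norm v = 1 \<and> (w - w') \<bullet> v = ((norm w)\<^sup>2 - (norm w')\<^sup>2) / 2})"
  have "finite B1" unfolding B1_def
    using assms by (intro finite_UN_I finite_Diff finite_sphere_Int_hyperplane_2) auto
  moreover have "finite B2" unfolding B2_def
    using assms by (intro finite_UN_I finite_Diff finite_sphere_Int_hyperplane_2) auto
  ultimately have "infinite (sphere 0 1 - (B1 \<union> B2))"
    using infinite_sphere_2 by (metis Diff_infinite_finite finite_Un)
  then obtain v where v: "norm v = 1" "v \<notin> B1" "v \<notin> B2"
    by (metis DiffE UnCI all_not_in_conv finite.emptyI mem_sphere_0)
  have sq: "(norm (w - v))\<^sup>2 = (norm w)\<^sup>2 + 1 - 2 * (w \<bullet> v)" for w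
    using v(1) by (simp add: power2_norm_eq_inner inner_diff inner_commute norm_eq_1)
  show thesis
  proof
    show "norm v = 1" by fact
    show "norm (w - v) \<notin> T" if "w \<in> W" "w \<noteq> 0" for w
    proof
      assume t: "norm (w - v) \<in> T"
      have "w \<bullet> v = ((norm w)\<^sup>2 + 1 - (norm (w - v))\<^sup>2) / 2" by (simp add: sq)
      then have "v \<in> B1" unfolding B1_def using that t v(1) by blast
      then show False using v by simp
    qed
    show "inj_on (\<lambda>w. norm (w - v)) W"
    proof (rule inj_onI, rule ccontr)
      fix w w' assume ww: "w \<in> W" "w' \<in> W" "norm (w - v) = norm (w' - v)" "w \<noteq> w'"
      have "(w - w') \<bullet> v = ((norm w)\<^sup>2 - (norm w')\<^sup>2) / 2"
        using sq[of w] sq[of w'] ww(3) by (simp add: inner_diff)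
      then have "v \<in> B2" unfolding B2_def using ww v(1) by blast
      then show False using v by simp
    qed
  qed
qed

section \<open>Counting ordered pairs under doubling\<close>

text \<open>Pairs are ordered so that each has a well-defined difference vector; for nonzero
  \<open>t\<close> and finite \<open>X\<close> the count is twice the multiplicity. At
  \<open>t = 0\<close> it is the diagonal.\<close>

definition dist_pairs :: "'a::metric_space set \<Rightarrow> real \<Rightarrow> ('a \<times> 'a) set" where
  "dist_pairs X t = {(x, y). x \<in> X \<and> y \<in> X \<and> dist x y = t}"

lemma finite_dist_pairs [simp]: "finite X \<Longrightarrow> finite (dist_pairs X t)"
  unfolding dist_pairs_def by (rule finite_subset[of _ "X \<times> X"]) auto

lemma dist_pairs_mono: "X \<subseteq> Y \<Longrightarrow> dist_pairs X t \<subseteq> dist_pairs Y t"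
  unfolding dist_pairs_def by auto

text \<open>Pairs lie inside \<open>X\<close>, inside the translate (via \<open>?s\<close>), or
  across the two copies, in one order (\<open>?f\<close>) or the other (\<open>?g\<close>).
  Disjointness of the copies makes these four families disjoint, and each map is injective.\<close>

lemma card_dist_pairs_translate_Un:
  fixes X :: "'a::real_normed_vector set" and v :: 'a and t :: real
  assumes X: "finite X" and disj: "X \<inter> (\<lambda>x. x + v) ` X = {}"
  defines "C \<equiv> {(x, y). x \<in> X \<and> y \<in> X \<and> norm (x - y - v) = t}"
  shows "card (dist_pairs (X \<union> (\<lambda>x. x + v) ` X) t) = 2 * card (dist_pairs X t) + 2 * card C"
proof -
  let ?P = "dist_pairs X t"
  let ?s = "\<lambda>(x, y). (x + v, y + v)"
  let ?f = "\<lambda>(x, y). (x, y + v)" and ?g = "\<lambda>(x, y). (y + v, x)"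
  have finC: "finite C"
    unfolding C_def by (rule finite_subset[of _ "X \<times> X"]) (use X in auto)
  have eq: "dist_pairs (X \<union> (\<lambda>x. x + v) ` X) t = (?P \<union> ?s ` ?P) \<union> (?f ` C \<union> ?g ` C)"
  proof (rule subset_antisym; rule subrelI)
    fix x y assume "(x, y) \<in> dist_pairs (X \<union> (\<lambda>x. x + v) ` X) t"
    then have d: "dist x y = t" and x: "x \<in> X \<union> (\<lambda>x. x + v) ` X" and y: "y \<in> X \<union> (\<lambda>x. x + v) ` X"
      by (auto simp: dist_pairs_def)
    consider "x \<in> X" "y \<in> X" | x' y' where "x' \<in> X" "y' \<in> X" "x = x' + v" "y = y' + v"
      | y' where "x \<in> X" "y' \<in> X" "y = y' + v" | x' where "x' \<in> X" "y \<in> X" "x = x' + v"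
      using x y by blast
    then show "(x, y) \<in> (?P \<union> ?s ` ?P) \<union> (?f ` C \<union> ?g ` C)"
    proof cases
      case 1 then show ?thesis using d by (auto simp: dist_pairs_def)
    next
      case 2
      then have "(x', y') \<in> ?P" using d by (auto simp: dist_pairs_def)
      then show ?thesis using 2 by force
    next
      case 3
      then have "(x, y') \<in> C" using d by (auto simp: C_def dist_norm algebra_simps)
      then show ?thesis using 3 by force
    next
      case 4
      then have "(y, x') \<in> C"
        using d by (auto simp: C_def dist_norm algebra_simps norm_minus_commute)
      then show ?thesis using 4 by force
    qed
  next
    fix x y assume "(x, y) \<in> (?P \<union> ?s ` ?P) \<union> (?f ` C \<union> ?g ` C)"
    then show "(x, y) \<in> dist_pairs (X \<union> (\<lambda>x. x + v) ` X) t"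
      by (auto simp: dist_pairs_def C_def dist_norm algebra_simps norm_minus_commute)
  qed
  have P: "card (?P \<union> ?s ` ?P) = card ?P + card ?P"
  proof (subst card_Un_disjoint)
    show "?P \<inter> ?s ` ?P = {}" using disj by (auto simp: dist_pairs_def)
    show "card ?P + card (?s ` ?P) = card ?P + card ?P"
      by (subst card_image) (auto simp: inj_on_def)
  qed (use X in auto)
  have C: "card (?f ` C \<union> ?g ` C) = card C + card C"
  proof (subst card_Un_disjoint)
    show "?f ` C \<inter> ?g ` C = {}" using disj by (auto simp: C_def)
    show "card (?f ` C) + card (?g ` C) = card C + card C"
      by (subst (1 2) card_image) (auto simp: inj_on_def)
  qed (use finC in auto)
  have "(?P \<union> ?s ` ?P) \<inter> (?f ` C \<union> ?g ` C) = {}"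
    using disj by (auto simp: C_def dist_pairs_def)
  then show ?thesis
    unfolding eq using X finC by (subst card_Un_disjoint) (simp_all add: P C)
qed

text \<open>A maximum rather than a sum appears because, for \<open>t\<close> other than 1, either
  no cross pair has distance \<open>t\<close>, or no pair inside \<open>X\<close> does.\<close>

lemma ex_doubling:
  fixes X :: "(real ^ 2) set"
  assumes X: "finite X"
  obtains Y where "finite Y" "X \<subseteq> Y" "card Y = 2 * card X"
    "2 * card (dist_pairs X 1) + 2 * card X \<le> card (dist_pairs Y 1)"
    "\<forall>t. t \<noteq> 1 \<longrightarrow> card (dist_pairs Y t) \<le> max (2 * card (dist_pairs X t)) (2 * card X)"
proof -
  define W where "W = (\<lambda>(x, y). x - y) ` (X \<times> X)"
  \<comment> \<open>The element 0 keeps \<open>v\<close> out of \<open>W\<close>, which makes the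
    two copies disjoint; the distances of \<open>X\<close> keep the cross distances of nonzero
    differences new.\<close>
  define T where "T = insert 0 (insert 1 ((\<lambda>(x, y). dist x y) ` (X \<times> X)))"
  have "finite W" "finite T" using X by (auto simp: W_def T_def)
  then obtain v where v1: "norm v = 1"
    and vT: "\<And>w. w \<in> W \<Longrightarrow> w \<noteq> 0 \<Longrightarrow> norm (w - v) \<notin> T"
    and vW: "inj_on (\<lambda>w. norm (w - v)) W"
    using ex_generic_unit_vector by blast
  have WI: "x - y \<in> W" if "x \<in> X" "y \<in> X" for x y using that by (auto simp: W_def)
  have disj: "X \<inter> (\<lambda>x. x + v) ` X = {}"
  proof (rule ccontr)
    assume "X \<inter> (\<lambda>x. x + v) ` X \<noteq> {}"
    then obtain x y where "x \<in> X" "y \<in> X" "x = y + v" by blast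
    then have "v \<in> W" using WI[of x y] by simp
    moreover have "v \<noteq> 0" using v1 by auto
    ultimately have "norm (v - v) \<notin> T" by (rule vT)
    then show False by (simp add: T_def)
  qed
  let ?Y = "X \<union> (\<lambda>x. x + v) ` X"
  define C where "C t = {(x, y). x \<in> X \<and> y \<in> X \<and> norm (x - y - v) = t}" for t
  have finC: "finite (C t)" for t
    unfolding C_def by (rule finite_subset[of _ "X \<times> X"]) (use X in auto)
  have cY: "card (dist_pairs ?Y t) = 2 * card (dist_pairs X t) + 2 * card (C t)" for t
    using card_dist_pairs_translate_Un[OF X disj] by (simp add: C_def)
  show thesis
  proof
    show "finite ?Y" "X \<subseteq> ?Y" using X by auto
    show "card ?Y = 2 * card X"
      using X disj by (subst card_Un_disjoint) (simp_all add: card_image)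
    \<comment> \<open>Each point \<open>x\<close> is at distance \<open>norm v = 1\<close> from its
      own translate.\<close>
    have "(\<lambda>x. (x, x)) ` X \<subseteq> C 1" using v1 by (auto simp: C_def)
    from card_mono[OF finC this] have "card X \<le> card (C 1)"
      by (simp add: card_image inj_on_def)
    then show "2 * card (dist_pairs X 1) + 2 * card X \<le> card (dist_pairs ?Y 1)"
      by (simp add: cY)
    have "card (dist_pairs ?Y t) \<le> max (2 * card (dist_pairs X t)) (2 * card X)" if "t \<noteq> 1" for t
    proof (cases "t \<in> T")
      case True
      \<comment> \<open>If \<open>x = y\<close> the cross distance is 1, hence not \<open>t\<close>;
        otherwise it avoids \<open>T\<close>.\<close>
      have "(x, y) \<notin> C t" for x y
        using vT[OF WI, of x y] v1 True that by (cases "x = y") (auto simp: C_def)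
      then have "C t = {}" by auto
      then show ?thesis by (simp add: cY)
    next
      case False
      then have "dist_pairs X t = {}" by (force simp: dist_pairs_def T_def)
      \<comment> \<open>All pairs in \<open>C t\<close> share one difference, by \<open>vW\<close>,
        so the first point determines the second.\<close>
      moreover have "card (C t) \<le> card X"
      proof (rule card_inj_on_le[of fst])
        show "inj_on fst (C t)"
        proof (rule inj_onI, clarsimp)
          fix x y y' assume "(x, y) \<in> C t" "(x, y') \<in> C t"
          then have "x - y = x - y'"
            by (intro inj_onD[OF vW]) (auto simp: C_def WI)
          then show "y = y'" by simp
        qed
      qed (use X in \<open>auto simp: C_def\<close>)
      ultimately show ?thesis by (simp add: cY)
    qed
    then show "\<forall>t. t \<noteq> 1 \<longrightarrow>
        card (dist_pairs ?Y t) \<le> max (2 * card (dist_pairs X t)) (2 * card X)" by blast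
  qed
qed

section \<open>The iterated construction\<close>

text \<open>The set is a generic planar image of the \<open>k\<close>-cube, whose edges have length
  1. Doubling preserves both bounds: \<open>2 * (k * 2 ^ k) + 2 * 2 ^ k = Suc k * 2 ^ Suc k\<close>,
  and both terms of the maximum are at most \<open>2 ^ Suc k\<close>.\<close>

lemma ex_generic_cube:
  "\<exists>X :: (real ^ 2) set. finite X \<and> card X = 2 ^ k \<and> k * 2 ^ k \<le> card (dist_pairs X 1) \<and>
     (\<forall>t. t \<noteq> 1 \<longrightarrow> card (dist_pairs X t) \<le> 2 ^ k)"
proof (induction k)
  case 0
  have "card (dist_pairs {0::real^2} t) \<le> 1" for t
    by (rule order_trans[OF card_mono[of "{(0,0)}"]]) (auto simp: dist_pairs_def)
  then show ?case by (intro exI[of _ "{0}"]) auto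
next
  case (Suc k)
  then obtain X :: "(real ^ 2) set" where X: "finite X" "card X = 2 ^ k" "k * 2 ^ k \<le> card (dist_pairs X 1)"
    "\<And>t. t \<noteq> 1 \<Longrightarrow> card (dist_pairs X t) \<le> 2 ^ k" by auto
  obtain Y where Y: "finite Y" "X \<subseteq> Y" "card Y = 2 * card X"
    "2 * card (dist_pairs X 1) + 2 * card X \<le> card (dist_pairs Y 1)"
    "\<forall>t. t \<noteq> 1 \<longrightarrow> card (dist_pairs Y t) \<le> max (2 * card (dist_pairs X t)) (2 * card X)"
    by (rule ex_doubling[OF X(1)])
  have "card (dist_pairs Y t) \<le> 2 ^ Suc k" if "t \<noteq> 1" for t
    using Y(5)[rule_format, OF that] X(4)[OF that] X(2) by simp
  then show ?case using X Y by (intro exI[of _ Y]) (auto simp: algebra_simps)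
qed

section \<open>From ordered pairs to the sorted multiplicities\<close>

lemma multiplicity_edges:
  assumes "d \<noteq> 0"
  shows "{{x, y} | x y. x \<in> X \<and> y \<in> X \<and> x \<noteq> y \<and> dist x y = d} = (\<lambda>(x, y). {x, y}) ` dist_pairs X d"
proof -
  have "{{x, y} | x y. x \<in> X \<and> y \<in> X \<and> x \<noteq> y \<and> dist x y = d}
      = {{x, y} | x y. (x, y) \<in> dist_pairs X d}"
    using assms by (metis (mono_tags, lifting) case_prodD case_prodI dist_eq_0_iff dist_pairs_def mem_Collect_eq)
  also have "\<dots> = (\<lambda>(x, y). {x, y}) ` dist_pairs X d" by (auto simp: image_iff Bex_def)
  finally show ?thesis .
qed

lemma multiplicity_of_le:
  assumes "finite X" "d \<noteq> 0"
  shows "multiplicity_of X d \<le> card (dist_pairs X d)"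
  unfolding multiplicity_of_def multiplicity_edges[OF assms(2)]
  using assms(1) by (intro card_image_le) simp

text \<open>Each fibre of the map from ordered to unordered pairs has at most two elements,
  \<open>(x, y)\<close> and \<open>(y, x)\<close>.\<close>

lemma card_dist_pairs_le:
  assumes "finite X" "d \<noteq> 0"
  shows "card (dist_pairs X d) \<le> 2 * multiplicity_of X d"
proof -
  let ?e = "\<lambda>(x, y). {x, y} :: (real^2) set"
  let ?F = "\<lambda>e. {p \<in> dist_pairs X d. ?e p = e}"
  have "card (?F e) \<le> 2" for e
  proof (cases "?F e = {}")
    case False
    then obtain x y where "e = {x, y}" by auto
    then have "?F e \<subseteq> {(x, y), (y, x)}" by (clarsimp simp: doubleton_eq_iff)
    then have "card (?F e) \<le> card {(x, y), (y, x)}" by (intro card_mono) auto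
    also have "\<dots> \<le> 2" by (cases "x = y") simp_all
    finally show ?thesis .
  next
    case True
    show ?thesis unfolding True by simp
  qed
  then have "(\<Sum>e \<in> ?e ` dist_pairs X d. card (?F e)) \<le> (\<Sum>e \<in> ?e ` dist_pairs X d. 2)"
    by (rule sum_mono)
  then have "card (\<Union>e \<in> ?e ` dist_pairs X d. ?F e) \<le> (\<Sum>e \<in> ?e ` dist_pairs X d. 2)"
    using assms(1) by (intro order_trans[OF card_UN_le]) (rule finite_imageI, simp)
  moreover have "(\<Union>e \<in> ?e ` dist_pairs X d. ?F e) = dist_pairs X d" by auto
  ultimately show ?thesis
    unfolding multiplicity_of_def multiplicity_edges[OF assms(2)] by simp
qed

text \<open>One dominant distance suffices to control the first two entries: its multiplicity can be
  placed at the head of the decreasing list, and every remaining entry is at most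
  \<open>U\<close>.\<close>

lemma dist_mult_bounds:
  assumes X: "finite X" and d: "d \<in> distances X"
    and le: "\<And>t. t \<in> distances X \<Longrightarrow> t \<noteq> d \<Longrightarrow> multiplicity_of X t \<le> U"
    and U: "U \<le> multiplicity_of X d"
  shows "dist_mult 1 X = multiplicity_of X d" "dist_mult 2 X \<le> U"
proof -
  have "distances X \<subseteq> (\<lambda>(x, y). dist x y) ` (X \<times> X)" by (auto simp: distances_def)
  then have fin: "finite (distances X)" using X by (meson finite_SigmaI finite_imageI finite_subset)
  define M where "M = image_mset (multiplicity_of X) (mset_set (distances X - {d}))"
  have M: "image_mset (multiplicity_of X) (mset_set (distances X)) = add_mset (multiplicity_of X d) M"
    using mset_set.remove[OF fin d] by (simp add: M_def)
  have MU: "m \<le> U" if "m \<in># M" for m using that fin le by (auto simp: M_def)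
  \<comment> \<open>The list is increasing before reversal, so the dominant entry goes last.\<close>
  have "sorted (sorted_list_of_multiset M @ [multiplicity_of X d])"
    using MU U by (fastforce simp: sorted_append)
  moreover have "mset (sorted_list_of_multiset M @ [multiplicity_of X d]) = add_mset (multiplicity_of X d) M"
    by simp
  ultimately have "sorted_list_of_multiset (add_mset (multiplicity_of X d) M)
      = sorted_list_of_multiset M @ [multiplicity_of X d]"
    by (metis sorted_list_of_multiset_mset sorted_sort_id)
  then have L: "multiplicity_list X = multiplicity_of X d # rev (sorted_list_of_multiset M)"
    by (simp add: multiplicity_list_def M)
  have "card (distances X) > 0" using fin d by (auto simp: card_gt_0_iff)
  then show "dist_mult 1 X = multiplicity_of X d" by (simp add: dist_mult_def L)
  have sz: "size M = card (distances X) - 1" using fin d by (simp add: M_def)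
  show "dist_mult 2 X \<le> U"
  proof (cases "2 \<le> card (distances X)")
    case True
    have "length (rev (sorted_list_of_multiset M)) = size M"
      by (metis length_rev mset_sorted_list_of_multiset size_mset)
    \<comment> \<open>The second multiplicity is entry 0 of the tail, which is nonempty since
      \<open>M\<close> has one element for each distance other than \<open>d\<close>.\<close>
    then have "rev (sorted_list_of_multiset M) ! 0 \<in> set (rev (sorted_list_of_multiset M))"
      using True sz by (intro nth_mem) simp
    then have "rev (sorted_list_of_multiset M) ! 0 \<in># M" by simp
    then show ?thesis using True MU by (simp add: dist_mult_def L)
  \<comment> \<open>With a single distance, the second multiplicity is 0 by convention.\<close>
  qed (simp add: dist_mult_def)
qed

section \<open>Arbitrary cardinalities and the final estimate\<close>

text \<open>A set \<open>Z\<close> of size \<open>n\<close> between \<open>X\<close> and its double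
  \<open>Y\<close> inherits the lower bound at distance 1 from \<open>X\<close> and the upper bounds
  at other distances from \<open>Y\<close>. Thus the gap is at least
  \<open>k * 2 ^ k / 2 - 2 * 2 ^ k\<close>.\<close>

lemma ex_large_multiplicity_gap:
  assumes n: "2 ^ k \<le> n" "n \<le> 2 ^ Suc k" and k: "8 \<le> k"
  shows "\<exists>X :: (real ^ 2) set. finite X \<and> card X = n \<and>
    real (dist_mult 1 X) - real (dist_mult 2 X) \<ge> 2 ^ k * (real k - 4) / 2"
proof -
  obtain X :: "(real ^ 2) set" where X: "finite X" "card X = 2 ^ k" "k * 2 ^ k \<le> card (dist_pairs X 1)"
    "\<And>t. t \<noteq> 1 \<Longrightarrow> card (dist_pairs X t) \<le> 2 ^ k"
    using ex_generic_cube[of k] by auto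
  obtain Y where Y: "finite Y" "X \<subseteq> Y" "card Y = 2 * card X"
    "2 * card (dist_pairs X 1) + 2 * card X \<le> card (dist_pairs Y 1)"
    "\<forall>t. t \<noteq> 1 \<longrightarrow> card (dist_pairs Y t) \<le> max (2 * card (dist_pairs X t)) (2 * card X)"
    by (rule ex_doubling[OF X(1)])
  obtain Z where Z: "X \<subseteq> Z" "Z \<subseteq> Y" "card Z = n"
    using exists_subset_between[of X n Y] X Y n by auto
  have finZ: "finite Z" using Z Y finite_subset by blast
  have "k * 2 ^ k \<le> card (dist_pairs Z 1)"
    using X(3) card_mono[OF finite_dist_pairs[OF finZ] dist_pairs_mono[OF Z(1)]] order_trans by blast
  also have "\<dots> \<le> 2 * multiplicity_of Z 1" using card_dist_pairs_le[OF finZ] by simp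
  finally have lower: "k * 2 ^ k \<le> 2 * multiplicity_of Z 1" .
  have upper: "multiplicity_of Z t \<le> 2 * 2 ^ k" if "t \<in> distances Z" "t \<noteq> 1" for t
  proof -
    have "t \<noteq> 0" using that by (auto simp: distances_def)
    then have "multiplicity_of Z t \<le> card (dist_pairs Z t)" by (rule multiplicity_of_le[OF finZ])
    also have "\<dots> \<le> card (dist_pairs Y t)"
      by (rule card_mono[OF finite_dist_pairs[OF Y(1)] dist_pairs_mono[OF Z(2)]])
    also have "\<dots> \<le> 2 * 2 ^ k" using Y(5)[rule_format, OF that(2)] X(4)[OF that(2)] X(2) by simp
    finally show ?thesis .
  qed
  \<comment> \<open>For such \<open>k\<close> distance 1 has multiplicity at least
    \<open>4 * 2 ^ k\<close>, so it dominates all others.\<close>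
  have "8 * 2 ^ k \<le> k * 2 ^ k" using k by simp
  then have U: "2 * 2 ^ k \<le> multiplicity_of Z 1" using lower by linarith
  have "card (dist_pairs Z 1) > 0"
    using \<open>k * 2 ^ k \<le> card (dist_pairs Z 1)\<close> k by (auto intro!: Nat.gr0I)
  then have "dist_pairs Z 1 \<noteq> {}" by auto
  then have "1 \<in> distances Z"
    unfolding dist_pairs_def distances_def by (smt (verit, best) Collect_empty_eq case_prod_conv dist_self mem_Collect_eq prod.exhaust)
  note b = dist_mult_bounds[OF finZ this upper U]
  have "real k * 2 ^ k \<le> 2 * real (multiplicity_of Z 1)"
    using of_nat_mono[OF lower, where 'a = real] by simp
  moreover have "real (dist_mult 2 Z) \<le> 2 * 2 ^ k"
    using of_nat_mono[OF b(2), where 'a = real] by simp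
  ultimately have "2 ^ k * (real k - 4) / 2 \<le> real (dist_mult 1 Z) - real (dist_mult 2 Z)"
    using b(1) by (simp add: field_simps)
  then show ?thesis using Z finZ by blast
qed

theorem corollary1p10:
  "\<exists>c>0. \<exists>n0::nat. \<forall>n\<ge>n0. \<exists>X :: (real ^ 2) set.
     finite X \<and> card X = n \<and>
     real (dist_mult 1 X) - real (dist_mult 2 X) \<ge> c * real n * ln (real n)"
\<comment> \<open>The threshold \<open>2 ^ 9\<close> forces \<open>k \<ge> 9\<close>, exactly where
  \<open>k + 1 \<le> 2 * (k - 4)\<close>. Then
  \<open>n * ln n \<le> 2 ^ Suc k * (k + 1) \<le> 4 * 2 ^ k * (k - 4)\<close>, which is 8 times the
  gap bound; hence 1/8.\<close>
proof (intro exI[of _ "1/8"] conjI exI[of _ "2 ^ 9"] allI impI)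
  fix n :: nat assume n: "2 ^ 9 \<le> n"
  then obtain k where k: "2 ^ k \<le> n" "n < 2 ^ Suc k"
    using ex_power_ivl1[of 2 n] by auto
  have "(2::nat) ^ 9 < 2 ^ Suc k" using n k by linarith
  then have "9 \<le> k" by (subst (asm) power_strict_increasing_iff) auto
  have "real n \<le> 2 ^ Suc k"
    using of_nat_mono[OF less_imp_le[OF k(2)], where 'a = real] by simp
  moreover have "ln (real n) \<le> real k + 1"
  proof -
    have "ln (real n) \<le> ln (2 ^ Suc k)"
      using calculation n by (subst ln_le_cancel_iff) auto
    also have "\<dots> = (real k + 1) * ln 2" by (subst ln_realpow) auto
    also have "\<dots> \<le> (real k + 1) * 1" using ln_2_less_1 by (intro mult_left_mono) auto
    finally show ?thesis by simp
  qed
  ultimately have "real n * ln (real n) \<le> 2 ^ Suc k * (real k + 1)"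
    using n by (intro mult_mono) auto
  also have "\<dots> \<le> 2 ^ Suc k * (2 * (real k - 4))"
    using \<open>9 \<le> k\<close> by (intro mult_left_mono) auto
  finally have "1/8 * real n * ln (real n) \<le> 2 ^ k * (real k - 4) / 2"
    by (simp add: algebra_simps)
  then show "\<exists>X :: (real ^ 2) set. finite X \<and> card X = n \<and>
      real (dist_mult 1 X) - real (dist_mult 2 X) \<ge> 1/8 * real n * ln (real n)"
    using ex_large_multiplicity_gap[of k n] k \<open>9 \<le> k\<close> by fastforce
qed simp

end
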